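(* Consider instances of the scheduling game $P||\sum_jC_j$ with $m$ machines and $n$ jobs. Let $\bar x$ be the randomized schedule that assigns each job to each machine with probability $\frac1m$. For any schedule $x$ and any optimal schedule $x^*$, $$\sum_j\mathbf E[C_j(\bar x_j,x_{-j})]\le C(x^* )+\Big(\frac12-\frac1{2m}\Big)\sum_jp_j.$$ In particular, the robust price of anarchy of $P||\sum_jC_j$ is at most $\frac32-\frac1{2m}$. This bound is tight, i.e., for every $m\ge1$ the supremum of the robust price of anarchy over all instances of $P||\sum_jC_j$ with $m$ machines equals $\frac32-\frac1{2m}$.
   Context: Scheduling game $P||\sum_jC_j$: there are jobs (players) $1,\dots,n$ and $m$ identical machines; job $j$ has processing time $p_j\in\mathbb R_+$ (on every machine). Each job's strategy set is the set of machines; in a schedule (profile) $x$, $x_j$ is the machine of job $j$. Jobs are indexed such that $p_j>p_{j'}$ implies $j>j'$, and on each machine the assigned jobs are processed in increasing order of index (shortest processing time first). The cost of job $j$ is its completion time $C_j(x)=\sum_{k\le j:\,x_k=x_j}p_k$, and the social cost is $C(x)=\sum_jC_j(x)$. A schedule is optimal if it minimizes $C$. $(t,x_{-j})$ denotes $x$ with job $j$ moved to machine $t$. Smoothness: an instance is $(\lambda,\mu)$-smooth if there is a (possibly randomized) schedule $\bar y$ such that for all schedules $x$ and all optimal $x^*$, $\sum_jC_j(\bar y_j,x_{-j})\le\lambda C(x^* )+\mu C(x)$ (left-hand side in expectation over $\bar y$ if it is randomized). The robust price of anarchy of an instance is $\inf\{\frac{\lambda}{1-\mu} : \text{the instance is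 }(\lambda,\mu)\text{-smooth},\ \mu<1\}$. *)

theory Defs
  imports "HOL-Probability.Probability"
begin

text \<open>
  Jobs are \<open>{1..n}\<close>, machines are \<open>{1..m}\<close>.  Schedules are extensional functions, so that there
  are exactly \<open>m ^ n\<close> of them.
\<close>

definition sched_instance :: "nat \<Rightarrow> (nat \<Rightarrow> real) \<Rightarrow> bool" where
  "sched_instance n p \<longleftrightarrow>
     (\<forall>j\<in>{1..n}. 0 \<le> p j) \<and>
     (\<forall>j\<in>{1..n}. \<forall>j'\<in>{1..n}. p j > p j' \<longrightarrow> j > j')"

definition schedules :: "nat \<Rightarrow> nat \<Rightarrow> (nat \<Rightarrow> nat) set" where
  "schedules m n = {1..n} \<rightarrow>\<^sub>E {1..m}"

definition completion_time :: "(nat \<Rightarrow> real) \<Rightarrow> (nat \<Rightarrow> nat) \<Rightarrow> nat \<Rightarrow> real" where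
  "completion_time p x j = (\<Sum>k\<in>{k\<in>{1..j}. x k = x j}. p k)"

definition social_cost :: "nat \<Rightarrow> (nat \<Rightarrow> real) \<Rightarrow> (nat \<Rightarrow> nat) \<Rightarrow> real" where
  "social_cost n p x = (\<Sum>j\<in>{1..n}. completion_time p x j)"

definition optimal_schedule :: "nat \<Rightarrow> nat \<Rightarrow> (nat \<Rightarrow> real) \<Rightarrow> (nat \<Rightarrow> nat) \<Rightarrow> bool" where
  "optimal_schedule m n p x \<longleftrightarrow>
     x \<in> schedules m n \<and> (\<forall>y\<in>schedules m n. social_cost n p x \<le> social_cost n p y)"

text \<open>A deterministic schedule \<open>y\<close> is the special case \<open>return_pmf y\<close>.\<close>

definition randomized_schedule :: "nat \<Rightarrow> nat \<Rightarrow> (nat \<Rightarrow> nat) pmf \<Rightarrow> bool" where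
  "randomized_schedule m n Y \<longleftrightarrow> set_pmf Y \<subseteq> schedules m n"

text \<open>
  Only the marginals are prescribed; the joint distribution is arbitrary.  Independent uniform
  choices are one such randomized schedule, see \<open>uniform_marginals_Pi_pmf\<close> below.
\<close>

definition uniform_marginals :: "nat \<Rightarrow> nat \<Rightarrow> (nat \<Rightarrow> nat) pmf \<Rightarrow> bool" where
  "uniform_marginals m n Y \<longleftrightarrow>
     randomized_schedule m n Y \<and>
     (\<forall>j\<in>{1..n}. \<forall>i\<in>{1..m}. measure_pmf.prob Y {y. y j = i} = 1 / real m)"

lemma uniform_marginals_Pi_pmf:
  assumes "m \<ge> 1"
  shows "uniform_marginals m n (Pi_pmf {1..n} undefined (\<lambda>_. pmf_of_set {1..m}))"
proof -
  let ?Y = "Pi_pmf {1..n} undefined (\<lambda>_. pmf_of_set {1..m})"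
  have ne: "{1..m} \<noteq> {}" using assms by simp
  have "set_pmf ?Y \<subseteq> schedules m n"
    using ne by (auto simp: schedules_def set_Pi_pmf PiE_dflt_def PiE_def extensional_def)
  moreover have "measure_pmf.prob ?Y {y. y j = i} = 1 / real m"
    if "j \<in> {1..n}" "i \<in> {1..m}" for i j
  proof -
    have "measure_pmf.prob ?Y {y. y j = i} = pmf (map_pmf (\<lambda>y. y j) ?Y) i"
      by (simp add: pmf_map vimage_def)
    also have "\<dots> = pmf (pmf_of_set {1..m}) i"
      using that by (subst Pi_pmf_component) auto
    also have "\<dots> = 1 / real m"
      using that ne by (simp add: pmf_of_set)
    finally show ?thesis .
  qed
  ultimately show ?thesis
    by (simp add: uniform_marginals_def randomized_schedule_def)
qed

definition smooth :: "nat \<Rightarrow> nat \<Rightarrow> (nat \<Rightarrow> real) \<Rightarrow> real \<Rightarrow> real \<Rightarrow> bool" where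
  "smooth m n p l u \<longleftrightarrow>
     (\<exists>Y. randomized_schedule m n Y \<and>
       (\<forall>x\<in>schedules m n. \<forall>xo. optimal_schedule m n p xo \<longrightarrow>
          measure_pmf.expectation Y (\<lambda>y. \<Sum>j\<in>{1..n}. completion_time p (x(j := y j)) j)
            \<le> l * social_cost n p xo + u * social_cost n p x))"

text \<open>
  The infimum is taken in the extended reals: if all costs vanish (no jobs, or only zero processing
  times), every pair of parameters is admissible and the infimum is \<open>- \<infinity>\<close>.
\<close>

definition robust_poa :: "nat \<Rightarrow> nat \<Rightarrow> (nat \<Rightarrow> real) \<Rightarrow> ereal" where
  "robust_poa m n p = Inf {ereal (l / (1 - u)) | l u. smooth m n p l u \<and> u < 1}"

end

theory Submission
  imports Defs
begin

text \<open>
  A job moved to a uniformly random machine waits for every shorter job with probability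
  \<open>1/m\<close>, whatever the schedule.  So the left-hand side is
  \<open>(\<Sum>j. p j + (\<Sum>k<j. p k) / m)\<close>, and the first claim is the classical lower bound on the cost of a
  schedule.  Both sides of that bound are linear in \<open>p\<close>, so by summation by parts it is enough to
  treat processing times that are \<open>0\<close> up to some job and \<open>1\<close> from there on, where it is
  Cauchy--Schwarz for the loads of the machines.  As \<open>(\<Sum>j. p j)\<close> is at most the cost of the optimum,
  every instance is \<open>(3/2 - 1/(2m), 0)\<close>-smooth.

  The bound is attained by \<open>m\<close> jobs of length \<open>1\<close>: averaged over all schedules \<open>x\<close>, both \<open>C(x)\<close> and,
  for every \<open>y\<close>, the sum of the \<open>C_j(y_j, x_{-j})\<close> equal \<open>m + (m-1)/2\<close>, whereas the optimum is \<open>m\<close>.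
\<close>

subsection \<open>Lower bound on the cost of a schedule\<close>

text \<open>Abel summation writes the sum as \<open>p 1\<close> times the full sum of
  \<open>g\<close> plus the increments of \<open>p\<close> times the later tail sums; no factor is
  negative.\<close>

lemma sum_mult_nonneg_if_tail_sums_nonneg:
  fixes p g :: "nat \<Rightarrow> real"
  assumes nonneg: "\<And>k. k \<in> {1..n} \<Longrightarrow> 0 \<le> p k"
    and mono: "\<And>j k. 1 \<le> j \<Longrightarrow> j \<le> k \<Longrightarrow> k \<le> n \<Longrightarrow> p j \<le> p k"
    and tails: "\<And>t. t \<in> {1..n} \<Longrightarrow> 0 \<le> (\<Sum>k=t..n. g k)"
  shows "0 \<le> (\<Sum>k=1..n. p k * g k)"
proof (cases "n = 0")
  case False
  \<comment> \<open>Induction downwards from \<open>n\<close>: the tail sum from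
    \<open>Suc t\<close> is nonnegative, so its factor \<open>p t\<close> may be raised to
    \<open>p (Suc t)\<close>, where the induction hypothesis applies.\<close>
  have "1 \<le> t \<longrightarrow> p t * (\<Sum>k=t..n. g k) \<le> (\<Sum>k=t..n. p k * g k)" if "t \<le> n" for t
    using that
  proof (induction t rule: inc_induct)
    case (step t)
    show ?case
    proof
      assume "1 \<le> t"
      have "p t * (\<Sum>k=t..n. g k) = p t * g t + p t * (\<Sum>k=Suc t..n. g k)"
        using step.hyps by (simp add: sum.atLeast_Suc_atMost[of t n] algebra_simps)
      also have "\<dots> \<le> p t * g t + p (Suc t) * (\<Sum>k=Suc t..n. g k)"
        using step.hyps \<open>1 \<le> t\<close> by (intro add_left_mono mult_right_mono mono tails) auto
      also have "\<dots> \<le> p t * g t + (\<Sum>k=Suc t..n. p k * g k)"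
        using step.IH by simp
      also have "\<dots> = (\<Sum>k=t..n. p k * g k)"
        using step.hyps by (simp add: sum.atLeast_Suc_atMost[of t n])
      finally show "p t * (\<Sum>k=t..n. g k) \<le> (\<Sum>k=t..n. p k * g k)" .
    qed
  qed simp
  from this[of 1] have "p 1 * (\<Sum>k=1..n. g k) \<le> (\<Sum>k=1..n. p k * g k)"
    using False by simp
  moreover have "0 \<le> p 1 * (\<Sum>k=1..n. g k)"
    using False by (intro mult_nonneg_nonneg nonneg tails) auto
  ultimately show ?thesis
    by (rule order_trans[rotated])
qed simp

text \<open>With \<open>N i\<close> the size of the fibre over \<open>i\<close>,
  \<open>card A\<close> is the sum of the \<open>N i\<close> and the sum on the right is that of
  their squares, so Cauchy--Schwarz applies.\<close>

lemma card_squared_le_card_mult_sum_card_fibres: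
  fixes A :: "'a set" and M :: "'b set"
  assumes "finite A" "finite M" "x ` A \<subseteq> M"
  shows "(real (card A))\<^sup>2 \<le> real (card M) * (\<Sum>k\<in>A. real (card {j\<in>A. x j = x k}))"
proof -
  define N where "N i = real (card {k\<in>A. x k = i})" for i
  have card_A: "real (card A) = (\<Sum>i\<in>M. N i)"
    unfolding N_def using sum.group[OF assms, of "\<lambda>_. 1 :: real"] by simp
  have "(\<Sum>k\<in>A. N (x k)) = (\<Sum>i\<in>M. \<Sum>k | k \<in> A \<and> x k = i. N (x k))"
    by (rule sum.group[OF assms, symmetric])
  also have "\<dots> = (\<Sum>i\<in>M. (N i)\<^sup>2)"
    by (rule sum.cong) (auto simp: N_def power2_eq_square)
  finally have "(\<Sum>k\<in>A. N (x k)) = (\<Sum>i\<in>M. (N i)\<^sup>2)" .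
  moreover have "(\<Sum>i\<in>M. N i)\<^sup>2 \<le> (\<Sum>i\<in>M. (N i)\<^sup>2) * real (card M)"
    by (rule sum_squared_le_sum_of_squares)
  ultimately show ?thesis
    unfolding card_A by (simp add: N_def mult.commute)
qed

text \<open>Add the sum to its copy with \<open>j\<close> and \<open>k\<close> exchanged: an ordered
  pair of distinct elements of a fibre is counted once, a diagonal pair twice, whence the extra
  \<open>card A\<close>.\<close>

lemma twice_sum_card_fibres_above:
  fixes A :: "'a :: linorder set"
  assumes "finite A"
  shows "2 * (\<Sum>k\<in>A. real (card {j\<in>A. k \<le> j \<and> x j = x k}))
    = (\<Sum>k\<in>A. real (card {j\<in>A. x j = x k})) + real (card A)"
proof -
  have card_eq: "real (card {j\<in>A. P j}) = (\<Sum>j\<in>A. if P j then 1 else 0)" for P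
    using assms by (simp add: sum.If_cases Int_def)
  let ?a = "\<lambda>k j. if k \<le> j \<and> x j = x k then 1 else 0 :: real"
  have "(\<Sum>k\<in>A. \<Sum>j\<in>A. ?a k j) + (\<Sum>k\<in>A. \<Sum>j\<in>A. ?a j k)
    = (\<Sum>k\<in>A. \<Sum>j\<in>A. (if x j = x k then 1 else 0) + (if j = k then 1 else 0))"
    unfolding sum.distrib[symmetric] by (intro sum.cong) auto
  moreover have "(\<Sum>k\<in>A. \<Sum>j\<in>A. ?a j k) = (\<Sum>k\<in>A. \<Sum>j\<in>A. ?a k j)"
    by (rule sum.swap)
  ultimately show ?thesis
    unfolding card_eq using assms by (simp add: sum.distrib)
qed

text \<open>Double counting: job \<open>k\<close> adds \<open>p k\<close> to its own completion time
  and to that of each later job on its machine.\<close>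

lemma social_cost_eq_sum_card_later:
  "social_cost n p x = (\<Sum>k=1..n. p k * real (card {j\<in>{k..n}. x j = x k}))"
proof -
  have "social_cost n p x = (\<Sum>j=1..n. \<Sum>k=1..n. if k \<le> j \<and> x k = x j then p k else 0)"
    unfolding social_cost_def completion_time_def
    by (intro sum.cong refl sum.mono_neutral_cong_left) auto
  also have "\<dots> = (\<Sum>k=1..n. \<Sum>j=1..n. if k \<le> j \<and> x k = x j then p k else 0)"
    by (rule sum.swap)
  also have "\<dots> = (\<Sum>k=1..n. \<Sum>j\<in>{j\<in>{k..n}. x j = x k}. p k)"
    by (intro sum.cong refl sum.mono_neutral_cong_right) auto
  finally show ?thesis
    by (simp add: mult.commute)
qed

lemma sum_real_diff_atLeastAtMost:
  "t \<le> Suc n \<Longrightarrow> (\<Sum>k=t..n. real (n - k)) = (real (Suc n - t))\<^sup>2 / 2 - real (Suc n - t) / 2"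
proof (induction t rule: inc_induct)
  case (step t)
  then show ?case
    by (simp add: sum.atLeast_Suc_atMost[of t n] Suc_diff_le power2_eq_square field_simps)
qed simp

lemma social_cost_lower_bound:
  assumes m: "m \<ge> 1" and p: "sched_instance n p" and x: "x \<in> schedules m n"
  shows "(\<Sum>k=1..n. p k * (real (n - k) / m + 1 / 2 + 1 / (2 * m))) \<le> social_cost n p x"
proof -
  \<comment> \<open>Difference of the coefficients of \<open>p k\<close> on the two sides; its tail
    sum from \<open>t\<close> is the claim for lengths 0 before \<open>t\<close> and 1 from
    \<open>t\<close> on.\<close>
  define g where
    "g k = real (card {j\<in>{k..n}. x j = x k}) - (real (n - k) / m + 1 / 2 + 1 / (2 * m))" for k
  have "0 \<le> (\<Sum>k=1..n. p k * g k)"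
  proof (rule sum_mult_nonneg_if_tail_sums_nonneg)
    show "0 \<le> p k" if "k \<in> {1..n}" for k
      using p that by (auto simp: sched_instance_def)
    show "p j \<le> p k" if "1 \<le> j" "j \<le> k" "k \<le> n" for j k
      using p that unfolding sched_instance_def by (meson atLeastAtMost_iff linorder_not_le order_trans)
  next
    fix t assume t: "t \<in> {1..n}"
    define N where "N = real (Suc n - t)"
    let ?A = "{t..n}"
    have "x ` ?A \<subseteq> {1..m}"
      using x t by (fastforce simp: schedules_def)
    \<comment> \<open>Cauchy--Schwarz bounds the ordered pairs sharing a machine. Keeping only
      \<open>k \<le> j\<close> gives half of that count plus \<open>N / 2\<close>. The summand
      \<open>1 / (2 * m)\<close> in the statement makes the tail sum of the left coefficients equal
      to the resulting bound.\<close>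
    from card_squared_le_card_mult_sum_card_fibres[OF _ _ this]
    have "N\<^sup>2 / m \<le> (\<Sum>k\<in>?A. real (card {j\<in>?A. x j = x k}))"
      using m by (simp add: N_def field_simps)
    also have "\<dots> = 2 * (\<Sum>k\<in>?A. real (card {j\<in>?A. k \<le> j \<and> x j = x k})) - N"
      using twice_sum_card_fibres_above[of ?A x] by (simp add: N_def)
    also have "(\<Sum>k\<in>?A. real (card {j\<in>?A. k \<le> j \<and> x j = x k}))
      = (\<Sum>k\<in>?A. real (card {j\<in>{k..n}. x j = x k}))"
      by (intro sum.cong refl arg_cong[where f = "\<lambda>S. real (card S)"]) auto
    finally have "N\<^sup>2 / (2 * m) + N / 2 \<le> (\<Sum>k\<in>?A. real (card {j\<in>{k..n}. x j = x k}))"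
      by (simp add: field_simps)
    moreover have "(\<Sum>k\<in>?A. real (n - k) / m + 1 / 2 + 1 / (2 * m)) = N\<^sup>2 / (2 * m) + N / 2"
      using t m sum_real_diff_atLeastAtMost[of t n]
      by (simp add: sum.distrib flip: sum_divide_distrib) (simp add: N_def field_simps)
    ultimately show "0 \<le> (\<Sum>k\<in>?A. g k)"
      by (simp add: g_def sum_subtractf)
  qed
  then show ?thesis
    unfolding social_cost_eq_sum_card_later g_def by (simp add: right_diff_distrib sum_subtractf)
qed

subsection \<open>Moving a job to a random machine\<close>

lemma completion_time_move:
  assumes "j \<ge> 1"
  shows "completion_time p (x(j := i)) j = p j + (\<Sum>k=1..<j. if x k = i then p k else 0)"
proof -
  have "{k\<in>{1..j}. (x(j := i)) k = (x(j := i)) j} = insert j {k\<in>{1..<j}. x k = i}"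
    using assms by auto
  then show ?thesis
    unfolding completion_time_def by (simp del: fun_upd_apply flip: sum.inter_filter)
qed

text \<open>Every earlier job sits on exactly one machine, so it delays \<open>j\<close> for exactly
  one target \<open>i\<close>; this is why the total does not depend on \<open>x\<close>.\<close>

lemma sum_completion_time_move:
  assumes "x \<in> schedules m n" "j \<in> {1..n}"
  shows "(\<Sum>i=1..m. completion_time p (x(j := i)) j) = m * p j + (\<Sum>k=1..<j. p k)"
proof -
  have "(\<Sum>i=1..m. \<Sum>k=1..<j. if x k = i then p k else 0)
    = (\<Sum>k=1..<j. \<Sum>i=1..m. if x k = i then p k else 0)"
    by (rule sum.swap)
  also have "\<dots> = (\<Sum>k=1..<j. p k)"
    using assms by (intro sum.cong) (auto simp: schedules_def PiE_iff)
  finally show ?thesis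
    using assms by (simp add: completion_time_move sum.distrib)
qed

text \<open>The integrand sees \<open>y\<close> only through \<open>y j\<close>, whose law is
  uniform on \<open>{1..m}\<close>.\<close>

lemma expectation_uniform_marginal:
  fixes f :: "nat \<Rightarrow> real"
  assumes Y: "uniform_marginals m n Y" and j: "j \<in> {1..n}"
  shows "measure_pmf.expectation Y (\<lambda>y. f (y j)) = (\<Sum>i=1..m. f i) / m"
proof -
  let ?Z = "map_pmf (\<lambda>y. y j) Y"
  have "set_pmf ?Z \<subseteq> {1..m}"
    using Y j by (fastforce simp: uniform_marginals_def randomized_schedule_def schedules_def)
  then have "measure_pmf.expectation ?Z f = (\<Sum>i=1..m. f i * pmf ?Z i)"
    by (intro integral_measure_pmf_real) auto
  also have "\<dots> = (\<Sum>i=1..m. f i / m)"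
    using Y j by (intro sum.cong) (auto simp: uniform_marginals_def pmf_map vimage_def)
  finally show ?thesis
    by (simp add: sum_divide_distrib)
qed

lemma sum_partial_sums:
  fixes p :: "nat \<Rightarrow> real"
  shows "(\<Sum>j=1..n. \<Sum>k=1..<j. p k) = (\<Sum>k=1..n. p k * real (n - k))"
proof -
  have "(\<Sum>j=1..n. \<Sum>k=1..<j. p k) = (\<Sum>j=1..n. \<Sum>k=1..n. if k < j then p k else 0)"
    by (intro sum.cong refl sum.mono_neutral_cong_left) auto
  also have "\<dots> = (\<Sum>k=1..n. \<Sum>j=1..n. if k < j then p k else 0)"
    by (rule sum.swap)
  also have "\<dots> = (\<Sum>k=1..n. \<Sum>j\<in>{Suc k..n}. p k)"
    by (intro sum.cong refl sum.mono_neutral_cong_right) auto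
  finally show ?thesis
    by (simp add: mult.commute)
qed

lemma sum_expectation_uniform_le:
  assumes m: "m \<ge> 1" and p: "sched_instance n p" and Y: "uniform_marginals m n Y"
    and x: "x \<in> schedules m n" and z: "z \<in> schedules m n"
  shows "(\<Sum>j=1..n. measure_pmf.expectation Y (\<lambda>y. completion_time p (x(j := y j)) j))
    \<le> social_cost n p z + (1 / 2 - 1 / (2 * real m)) * (\<Sum>j=1..n. p j)"
proof -
  have "(\<Sum>j=1..n. measure_pmf.expectation Y (\<lambda>y. completion_time p (x(j := y j)) j))
    = (\<Sum>j=1..n. p j + (\<Sum>k=1..<j. p k) / m)"
  proof (rule sum.cong)
    fix j assume j: "j \<in> {1..n}"
    show "measure_pmf.expectation Y (\<lambda>y. completion_time p (x(j := y j)) j)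
      = p j + (\<Sum>k=1..<j. p k) / m"
      using expectation_uniform_marginal[OF Y j, of "\<lambda>i. completion_time p (x(j := i)) j"] m
      by (simp add: sum_completion_time_move[OF x j] add_divide_distrib del: One_nat_def)
  qed simp
  also have "\<dots> = (\<Sum>k=1..n. p k + p k * real (n - k) / m)"
    using sum_partial_sums[of p n] by (simp add: sum.distrib flip: sum_divide_distrib)
  \<comment> \<open>The coefficient 1 of \<open>p k\<close> is split into
    \<open>1 / 2 + 1 / (2 * m)\<close>, as in the lower bound, and the remainder
    \<open>1 / 2 - 1 / (2 * m)\<close>.\<close>
  also have "\<dots> = (\<Sum>k=1..n. p k * (real (n - k) / m + 1 / 2 + 1 / (2 * m)))
      + (1 / 2 - 1 / (2 * real m)) * (\<Sum>j=1..n. p j)"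
    unfolding sum_distrib_left sum.distrib[symmetric]
    by (rule sum.cong) (auto simp: algebra_simps)
  also have "\<dots> \<le> social_cost n p z + (1 / 2 - 1 / (2 * real m)) * (\<Sum>j=1..n. p j)"
    using social_cost_lower_bound[OF m p z] by simp
  finally show ?thesis .
qed

subsection \<open>Upper bound on the robust price of anarchy\<close>

lemma finite_schedules: "finite (schedules m n)"
  unfolding schedules_def by (intro finite_PiE) auto

lemma sum_processing_times_le_social_cost:
  assumes "\<forall>j\<in>{1..n}. 0 \<le> p j"
  shows "(\<Sum>j=1..n. p j) \<le> social_cost n p x"
  unfolding social_cost_def
proof (rule sum_mono)
  fix j assume j: "j \<in> {1..n}"
  have "p j = (\<Sum>k\<in>{j}. p k)" by simp
  also have "\<dots> \<le> completion_time p x j"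
    unfolding completion_time_def using j assms by (intro sum_mono2) auto
  finally show "p j \<le> completion_time p x j" .
qed

lemma expectation_sum_randomized_schedule:
  fixes f :: "'i \<Rightarrow> (nat \<Rightarrow> nat) \<Rightarrow> real"
  assumes "randomized_schedule m n Y"
  shows "measure_pmf.expectation Y (\<lambda>y. \<Sum>j\<in>J. f j y)
    = (\<Sum>j\<in>J. measure_pmf.expectation Y (f j))"
proof -
  \<comment> \<open>Finite support makes every summand integrable.\<close>
  have "finite (set_pmf Y)"
    using assms finite_subset[OF _ finite_schedules] by (auto simp: randomized_schedule_def)
  then show ?thesis
    by (intro Bochner_Integration.integral_sum integrable_measure_pmf_finite)
qed

text \<open>Bounding the total processing time by the optimal cost gives \<lambda> = 1 + (1/2 -
  1/(2m)); the bound involves no C(x), so \<mu> = 0.\<close>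

lemma smooth_uniform:
  assumes m: "m \<ge> 1" and p: "sched_instance n p"
  shows "smooth m n p (3 / 2 - 1 / (2 * real m)) 0"
proof -
  obtain Y where Y: "uniform_marginals m n Y"
    using uniform_marginals_Pi_pmf[OF m] by blast
  then have rY: "randomized_schedule m n Y"
    by (simp add: uniform_marginals_def)
  have "(\<Sum>j=1..n. measure_pmf.expectation Y (\<lambda>y. completion_time p (x(j := y j)) j))
      \<le> (3 / 2 - 1 / (2 * real m)) * social_cost n p xo"
    if x: "x \<in> schedules m n" and xo: "optimal_schedule m n p xo" for x xo
  proof -
    have "(1 / 2 - 1 / (2 * real m)) * (\<Sum>j=1..n. p j)
      \<le> (1 / 2 - 1 / (2 * real m)) * social_cost n p xo"
      using p m by (intro mult_left_mono sum_processing_times_le_social_cost)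
        (auto simp: sched_instance_def field_simps)
    moreover have "xo \<in> schedules m n"
      using xo by (simp add: optimal_schedule_def)
    ultimately show ?thesis
      using sum_expectation_uniform_le[OF m p Y x, of xo] by (simp add: algebra_simps)
  qed
  then show ?thesis
    unfolding smooth_def using rY by (intro exI[of _ Y]) (simp add: expectation_sum_randomized_schedule)
qed

lemma robust_poa_le:
  assumes "m \<ge> 1" "sched_instance n p"
  shows "robust_poa m n p \<le> ereal (3 / 2 - 1 / (2 * real m))"
proof -
  have "\<exists>l u. ereal (3 / 2 - 1 / (2 * real m)) = ereal (l / (1 - u)) \<and> smooth m n p l u \<and> u < 1"
    using smooth_uniform[OF assms]
    by (intro exI[of _ "3 / 2 - 1 / (2 * real m)"] exI[of _ 0]) simp
  then show ?thesis
    unfolding robust_poa_def by (intro Inf_lower) blast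
qed

subsection \<open>Tightness\<close>

text \<open>Resampling coordinate \<open>j\<close> preserves the uniform distribution on schedules:
  exchanging \<open>x j\<close> with \<open>i\<close> is an involution on pairs of a schedule and a
  machine.\<close>

lemma sum_schedules_update:
  fixes F :: "(nat \<Rightarrow> nat) \<Rightarrow> real"
  assumes "j \<in> {1..n}"
  shows "(\<Sum>x\<in>schedules m n. \<Sum>i=1..m. F (x(j := i))) = m * (\<Sum>x\<in>schedules m n. F x)"
proof -
  let ?S = "schedules m n \<times> {1..m}"
  let ?h = "\<lambda>(x, i). (x(j := i), x j) :: (nat \<Rightarrow> nat) \<times> nat"
  have "bij_betw ?h ?S ?S"
    using assms by (intro bij_betw_byWitness[where f' = ?h])
      (auto simp: schedules_def PiE_iff extensional_def)
  then have "(\<Sum>z\<in>?S. F (fst (?h z))) = (\<Sum>z\<in>?S. F (fst z))"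
    by (rule sum.reindex_bij_betw)
  then have "(\<Sum>(x, i)\<in>?S. F (x(j := i))) = (\<Sum>(x, i)\<in>?S. F x)"
    by (simp add: case_prod_unfold)
  then show ?thesis
    by (simp add: sum_distrib_left flip: sum.cartesian_product)
qed

lemma sum_schedules_completion_time_unit:
  assumes m: "m \<ge> 1" and j: "j \<in> {1..n}"
  shows "(\<Sum>x\<in>schedules m n. completion_time (\<lambda>_. 1) x j)
    = card (schedules m n) * (1 + real (j - 1) / m)"
proof -
  have "m * (\<Sum>x\<in>schedules m n. completion_time (\<lambda>_. 1) x j)
    = (\<Sum>x\<in>schedules m n. \<Sum>i=1..m. completion_time (\<lambda>_. 1) (x(j := i)) j)"
    by (rule sum_schedules_update[OF j, symmetric])
  also have "\<dots> = (\<Sum>x\<in>schedules m n. m + real (j - 1))"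
    by (intro sum.cong) (simp_all add: sum_completion_time_move[OF _ j] del: One_nat_def)
  finally show ?thesis
    using m by (simp add: field_simps)
qed

text \<open>Resampling coordinate \<open>k\<close> hits \<open>i\<close> for exactly one of the
  \<open>m\<close> choices.\<close>

lemma card_schedules_fixed:
  assumes "k \<in> {1..n}" "i \<in> {1..m}"
  shows "(\<Sum>x\<in>schedules m n. if x k = i then 1 else 0) = card (schedules m n) / real m"
  using sum_schedules_update[OF assms(1), where m = m and F = "\<lambda>x. if x k = i then 1 else 0"] assms(2)
  by (simp add: field_simps)

text \<open>Each of the \<open>j - 1\<close> earlier jobs is on \<open>i\<close> in a fraction 1/m
  of the schedules. The total is the same as without the move, so against a uniformly random
  \<open>x\<close> no target machine helps.\<close>

lemma sum_schedules_completion_time_move_unit: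
  assumes j: "j \<in> {1..n}" and i: "i \<in> {1..m}"
  shows "(\<Sum>x\<in>schedules m n. completion_time (\<lambda>_. 1) (x(j := i)) j)
    = card (schedules m n) * (1 + real (j - 1) / m)"
proof -
  have "(\<Sum>x\<in>schedules m n. \<Sum>k=1..<j. if x k = i then 1 else 0)
    = (\<Sum>k=1..<j. \<Sum>x\<in>schedules m n. if x k = i then 1 else 0 :: real)"
    by (rule sum.swap)
  also have "\<dots> = (\<Sum>k=1..<j. card (schedules m n) / real m)"
    using j i by (intro sum.cong card_schedules_fixed) auto
  finally show ?thesis
    using j by (simp add: completion_time_move sum.distrib algebra_simps)
qed

text \<open>Summing the smoothness inequality over all \<open>x\<close> eliminates \<open>Y\<close>
  and leaves \<open>V \<le> l * m + u * V\<close>.\<close>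

lemma smooth_unit_instance_bound:
  assumes m: "m \<ge> 1" and sm: "smooth m m (\<lambda>_. 1) l u"
  shows "(1 - u) * (3 / 2 - 1 / (2 * real m)) \<le> l"
proof -
  define p :: "nat \<Rightarrow> real" where "p = (\<lambda>_. 1)"
  define S where "S = schedules m m"
  \<comment> \<open>Average over \<open>x\<close> both of the social cost and, for any fixed
    schedule \<open>y\<close>, of the summed costs after the moves to \<open>y j\<close>.\<close>
  define V where "V = (\<Sum>j=1..m. 1 + real (j - 1) / m)"
  \<comment> \<open>One job per machine: nobody waits, so the cost meets the lower bound
    \<open>m\<close>, the total processing time.\<close>
  define xo where "xo = (\<lambda>j\<in>{1..m}. j)"
  have card_S: "card S > 0"
    using m by (simp add: S_def schedules_def card_PiE)
  have V: "V = m * (3 / 2 - 1 / (2 * real m))"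
  proof -
    have "(\<Sum>j=1..m. real (j - 1)) = m * (real m - 1) / 2"
      by (induction m) (auto simp: field_simps)
    moreover have "V = m + (\<Sum>j=1..m. real (j - 1)) / m"
      by (simp add: V_def sum.distrib flip: sum_divide_distrib)
    ultimately show ?thesis
      using m by (simp add: field_simps)
  qed
  have xo_cost: "social_cost m p xo = m"
  proof -
    have "{k \<in> {1..j}. xo k = xo j} = {j}" if "j \<in> {1..m}" for j
      using that by (auto simp: xo_def)
    then show ?thesis
      by (simp add: social_cost_def completion_time_def p_def)
  qed
  have "xo \<in> schedules m m"
    by (auto simp: xo_def schedules_def)
  moreover have "m \<le> social_cost m p y" for y
    using sum_processing_times_le_social_cost[of m p y] by (simp add: p_def)
  ultimately have xo: "optimal_schedule m m p xo"
    by (simp add: optimal_schedule_def xo_cost)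
  obtain Y where Y: "randomized_schedule m m Y"
    and le: "\<And>x. x \<in> S \<Longrightarrow>
      measure_pmf.expectation Y (\<lambda>y. \<Sum>j=1..m. completion_time p (x(j := y j)) j)
        \<le> l * m + u * social_cost m p x"
    using sm xo unfolding smooth_def p_def[symmetric] S_def by (auto simp flip: xo_cost)
  have "card S * V
    = measure_pmf.expectation Y (\<lambda>y. \<Sum>x\<in>S. \<Sum>j=1..m. completion_time p (x(j := y j)) j)"
  proof -
    have "(\<Sum>x\<in>S. \<Sum>j=1..m. completion_time p (x(j := y j)) j) = card S * V"
      if "y \<in> set_pmf Y" for y
    proof -
      have "(\<Sum>x\<in>S. \<Sum>j=1..m. completion_time p (x(j := y j)) j)
        = (\<Sum>j=1..m. \<Sum>x\<in>S. completion_time p (x(j := y j)) j)"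
        by (rule sum.swap)
      also have "\<dots> = (\<Sum>j=1..m. card S * (1 + real (j - 1) / m))"
        unfolding S_def p_def using that Y
        by (intro sum.cong sum_schedules_completion_time_move_unit)
          (auto simp: randomized_schedule_def schedules_def PiE_iff subset_iff)
      finally show ?thesis
        by (simp add: V_def sum_distrib_left)
    qed
    then have "measure_pmf.expectation Y (\<lambda>y. \<Sum>x\<in>S. \<Sum>j=1..m. completion_time p (x(j := y j)) j)
      = measure_pmf.expectation Y (\<lambda>_. card S * V)"
      by (intro integral_cong_AE) (auto simp: AE_measure_pmf_iff)
    then show ?thesis
      by simp
  qed
  also have "\<dots> = (\<Sum>x\<in>S. measure_pmf.expectation Y
      (\<lambda>y. \<Sum>j=1..m. completion_time p (x(j := y j)) j))"
    by (rule expectation_sum_randomized_schedule[OF Y])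
  also have "\<dots> \<le> (\<Sum>x\<in>S. l * m + u * social_cost m p x)"
    by (intro sum_mono le)
  also have "\<dots> = card S * (l * m) + u * (\<Sum>x\<in>S. social_cost m p x)"
    by (simp add: sum.distrib sum_distrib_left)
  also have "(\<Sum>x\<in>S. social_cost m p x) = (\<Sum>j=1..m. \<Sum>x\<in>S. completion_time p x j)"
    unfolding social_cost_def by (rule sum.swap)
  also have "\<dots> = card S * V"
    unfolding S_def p_def V_def sum_distrib_left
    by (intro sum.cong sum_schedules_completion_time_unit[OF m]) auto
  finally have "card S * V \<le> card S * (l * m + u * V)"
    by (simp add: algebra_simps)
  then have "V \<le> l * m + u * V"
    using card_S by simp
  then have "(1 - u) * V / m \<le> l"
    using m by (simp add: pos_divide_le_eq left_diff_distrib)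
  then show ?thesis
    using m by (simp add: V del: One_nat_def)
qed

lemma robust_poa_unit_instance_ge:
  assumes "m \<ge> 1"
  shows "ereal (3 / 2 - 1 / (2 * real m)) \<le> robust_poa m m (\<lambda>_. 1)"
  unfolding robust_poa_def
proof (rule Inf_greatest, clarify)
  fix l u :: real
  assume "smooth m m (\<lambda>_. 1) l u" "u < 1"
  with smooth_unit_instance_bound[OF assms this(1)]
  show "ereal (3 / 2 - 1 / (2 * real m)) \<le> ereal (l / (1 - u))"
    by (simp add: pos_le_divide_eq mult.commute)
qed

theorem theorem6:
  fixes m :: nat
  assumes "m \<ge> 1"
  shows
    "(\<forall>n p xbar x xo. sched_instance n p \<longrightarrow> uniform_marginals m n xbar \<longrightarrow>
        x \<in> schedules m n \<longrightarrow> optimal_schedule m n p xo \<longrightarrow>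
        (\<Sum>j\<in>{1..n}. measure_pmf.expectation xbar (\<lambda>y. completion_time p (x(j := y j)) j))
          \<le> social_cost n p xo + (1 / 2 - 1 / (2 * real m)) * (\<Sum>j\<in>{1..n}. p j)) \<and>
     (\<forall>n p. sched_instance n p \<longrightarrow> robust_poa m n p \<le> ereal (3 / 2 - 1 / (2 * real m))) \<and>
     (SUP (n, p)\<in>{(n, p). sched_instance n p}. robust_poa m n p)
       = ereal (3 / 2 - 1 / (2 * real m))"
proof (intro conjI allI impI)
  fix n p xbar x xo
  assume "sched_instance n p" "uniform_marginals m n xbar" "x \<in> schedules m n"
    "optimal_schedule m n p xo"
  then show "(\<Sum>j\<in>{1..n}. measure_pmf.expectation xbar (\<lambda>y. completion_time p (x(j := y j)) j))
      \<le> social_cost n p xo + (1 / 2 - 1 / (2 * real m)) * (\<Sum>j\<in>{1..n}. p j)"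
    by (intro sum_expectation_uniform_le assms) (simp_all add: optimal_schedule_def)
next
  fix n p assume "sched_instance n p"
  then show "robust_poa m n p \<le> ereal (3 / 2 - 1 / (2 * real m))"
    by (rule robust_poa_le[OF assms])
next
  show "(SUP (n, p)\<in>{(n, p). sched_instance n p}. robust_poa m n p)
       = ereal (3 / 2 - 1 / (2 * real m))"
  proof (rule antisym)
    show "(SUP (n, p)\<in>{(n, p). sched_instance n p}. robust_poa m n p)
       \<le> ereal (3 / 2 - 1 / (2 * real m))"
      by (rule SUP_least) (auto intro: robust_poa_le[OF assms])
    \<comment> \<open>The supremum is attained at \<open>m\<close> unit jobs.\<close>
    have "(m, \<lambda>_. 1) \<in> {(n, p). sched_instance n p}"
      by (simp add: sched_instance_def)
    then show "ereal (3 / 2 - 1 / (2 * real m))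
       \<le> (SUP (n, p)\<in>{(n, p). sched_instance n p}. robust_poa m n p)"
      by (rule SUP_upper2) (simp add: robust_poa_unit_instance_ge[OF assms])
  qed
qed

end
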